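(* Fix integers $r>0$ and $a,b$ with $\gcd(a,b)=1$ and $ab<0$. Then there is $N$ such that for $n\ge N$ the cardinality $\#B^r_{a,b;n}$ agrees with a quasipolynomial in $n$ of period $|ab|$, i.e. there are polynomials $p_1,\dots,p_{|ab|}$ with $\#B^r_{a,b;n}=p_l(n)$ whenever $n\ge N$ and $n\equiv l\pmod{|ab|}$.
   Context: Partitions are identified with Young diagrams: finite sets $\lambda\subset\mathbb{Z}_{\ge0}^2$ such that $(i,j)\in\lambda$ implies $(i',j')\in\lambda$ for $0\le i'\le i$, $0\le j'\le j$. Box $(i,j)$ has color $ai+bj\bmod n$. $\lambda$ is $(a,b;n)$-balanced if each residue class mod $n$ is the color of exactly $r$ boxes of $\lambda$; $B^r_{a,b;n}$ is the set of $(a,b;n)$-balanced partitions of $rn$. *)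

theory Defs
  imports Main "HOL-Computational_Algebra.Polynomial"
begin

definition young_diagram :: "(nat \<times> nat) set \<Rightarrow> bool" where
  "young_diagram lam \<longleftrightarrow> finite lam \<and>
     (\<forall>i j i' j'. (i, j) \<in> lam \<and> i' \<le> i \<and> j' \<le> j \<longrightarrow> (i', j') \<in> lam)"

definition box_color :: "int \<Rightarrow> int \<Rightarrow> nat \<Rightarrow> nat \<times> nat \<Rightarrow> int" where
  "box_color a b n x = (a * int (fst x) + b * int (snd x)) mod int n"

definition balanced :: "int \<Rightarrow> int \<Rightarrow> nat \<Rightarrow> nat \<Rightarrow> (nat \<times> nat) set \<Rightarrow> bool" where
  "balanced a b n r lam \<longleftrightarrow>
     (\<forall>c \<in> {0..<int n}. card {x \<in> lam. box_color a b n x = c} = r)"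

definition balanced_partitions :: "nat \<Rightarrow> int \<Rightarrow> int \<Rightarrow> nat \<Rightarrow> (nat \<times> nat) set set" where
  "balanced_partitions r a b n =
     {lam. young_diagram lam \<and> card lam = r * n \<and> balanced a b n r lam}"

end

theory Submission
  imports Defs Complex_Main
begin

text \<open>
  By transposition we may take \<open>a = A > 0\<close> and \<open>b = - B < 0\<close>. A diagram is determined by the numbers
  \<open>N c\<close> of its boxes \<open>(i, j)\<close> of level \<open>A * i - B * j = c\<close>, and being a Young diagram amounts to
  inequalities between \<open>N c\<close>, \<open>N (c - A)\<close> and \<open>N (c - B)\<close>. If the diagram is balanced modulo \<open>n\<close>,
  then \<open>N\<close> is supported on boundedly many intervals of length \<open>n\<close> and bounded by \<open>r\<close>. Stacking these
  intervals as rows and cutting the resulting array into blocks of \<open>P = A * B\<close> columns turns \<open>N\<close> into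
  a walk of length about \<open>n / P\<close> in a finite graph which depends only on \<open>n mod P\<close>, with a boundary
  condition linking the two ends. Along a walk the rows of nonnegative level decrease and those of
  negative level increase, so the only cycles of the graph are loops at single vertices; the number
  of walks of length \<open>m\<close> in such a graph is eventually a polynomial in \<open>m\<close>.
\<close>

subsection \<open>Walks in finite graphs without proper cycles\<close>

text \<open>The binomial expansion of \<open>(x + 1) ^ Suc k - x ^ Suc k\<close> has top term
  \<open>Suc k * x ^ k\<close>. The lower powers have antidifferences by induction and are
  subtracted.\<close>

lemma power_antidifference:
  "\<exists>p :: real poly. \<forall>x. poly p (x + 1) - poly p x = x ^ k"
proof (induction k rule: less_induct)
  case (less k)
  then obtain P :: "nat \<Rightarrow> real poly"
    where P: "poly (P i) (x + 1) - poly (P i) x = x ^ i" if "i < k" for i x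
    by metis
  define p where "p = smult (1 / real (Suc k))
    (monom 1 (Suc k) - (\<Sum>i<k. smult (real (Suc k choose i)) (P i)))"
  have "poly p (x + 1) - poly p x = x ^ k" for x
  proof -
    have "(x + 1) ^ Suc k = (\<Sum>i\<le>Suc k. real (Suc k choose i) * x ^ i)"
      by (subst binomial_ring) simp
    also have "\<dots> = (\<Sum>i<k. real (Suc k choose i) * x ^ i) + real (Suc k) * x ^ k + x ^ Suc k"
      by (simp add: lessThan_Suc_atMost[symmetric])
    finally have 1: "(x + 1) ^ Suc k - x ^ Suc k
        = (\<Sum>i<k. real (Suc k choose i) * x ^ i) + real (Suc k) * x ^ k"
      by simp
    have 2: "(\<Sum>i<k. real (Suc k choose i) * poly (P i) (x + 1))
        - (\<Sum>i<k. real (Suc k choose i) * poly (P i) x)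
        = (\<Sum>i<k. real (Suc k choose i) * x ^ i)"
      by (simp add: sum_subtractf[symmetric] right_diff_distrib[symmetric] P)
    have "real (Suc k) * (poly p (x + 1) - poly p x)
        = ((x + 1) ^ Suc k - x ^ Suc k)
          - ((\<Sum>i<k. real (Suc k choose i) * poly (P i) (x + 1))
        - (\<Sum>i<k. real (Suc k choose i) * poly (P i) x))"
      by (simp add: p_def poly_monom poly_sum right_diff_distrib del: of_nat_Suc power_Suc)
    also have "\<dots> = real (Suc k) * x ^ k"
      unfolding 1 2 by simp
    finally show ?thesis
      by (simp del: of_nat_Suc)
  qed
  then show ?case by blast
qed

lemma poly_antidifference:
  "\<exists>p :: real poly. \<forall>x. poly p (x + 1) - poly p x = poly q x"
proof -
  obtain P :: "nat \<Rightarrow> real poly" where P: "poly (P i) (x + 1) - poly (P i) x = x ^ i" for i x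
    using power_antidifference by metis
  have "poly (\<Sum>i\<le>degree q. smult (coeff q i) (P i)) (x + 1)
      - poly (\<Sum>i\<le>degree q. smult (coeff q i) (P i)) x = poly q x" for x
    by (subst (3) poly_altdef)
      (simp add: poly_sum sum_subtractf[symmetric] right_diff_distrib[symmetric] P)
  then show ?thesis by blast
qed

section \<open>Sequences of naturals that are eventually polynomial\<close>

definition eventually_poly :: "(nat \<Rightarrow> nat) \<Rightarrow> bool" where
  "eventually_poly f \<longleftrightarrow> (\<exists>p :: real poly. \<forall>\<^sub>F m in sequentially. real (f m) = poly p (real m))"

lemma eventually_poly_const: "eventually_poly (\<lambda>m. c)"
  unfolding eventually_poly_def by (rule exI[of _ "[:real c:]"]) simp

lemma eventually_poly_add:
  assumes "eventually_poly f" "eventually_poly g"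
  shows "eventually_poly (\<lambda>m. f m + g m)"
proof -
  from assms obtain p q where "\<forall>\<^sub>F m in sequentially. real (f m) = poly p (real m)"
    "\<forall>\<^sub>F m in sequentially. real (g m) = poly q (real m)"
    unfolding eventually_poly_def by blast
  then have "\<forall>\<^sub>F m in sequentially. real (f m + g m) = poly (p + q) (real m)"
    by eventually_elim simp
  then show ?thesis unfolding eventually_poly_def by blast
qed

lemma eventually_poly_cmult:
  assumes "eventually_poly f"
  shows "eventually_poly (\<lambda>m. f m * c)"
proof -
  from assms obtain p where "\<forall>\<^sub>F m in sequentially. real (f m) = poly p (real m)"
    unfolding eventually_poly_def by blast
  then have "\<forall>\<^sub>F m in sequentially. real (f m * c) = poly (smult (real c) p) (real m)"
    by eventually_elim simp
  then show ?thesis unfolding eventually_poly_def by blast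
qed

lemma eventually_poly_sum:
  assumes "\<And>x. x \<in> A \<Longrightarrow> eventually_poly (f x)"
  shows "eventually_poly (\<lambda>m. \<Sum>x\<in>A. f x m)"
  using assms
  by (induction A rule: infinite_finite_induct)
    (simp_all add: eventually_poly_const eventually_poly_add)

lemma eventually_poly_Suc_iff:
  "eventually_poly (\<lambda>m. f (Suc m)) \<longleftrightarrow> eventually_poly f"
proof
  assume "eventually_poly (\<lambda>m. f (Suc m))"
  then obtain p where "\<forall>\<^sub>F m in sequentially. real (f (Suc m)) = poly p (real m)"
    unfolding eventually_poly_def by blast
  then have "\<forall>\<^sub>F m in sequentially. real (f (Suc m)) = poly (p \<circ>\<^sub>p [:-1, 1:]) (real (Suc m))"
    by eventually_elim (simp add: poly_pcompose)
  then have "\<forall>\<^sub>F m in sequentially. real (f m) = poly (p \<circ>\<^sub>p [:-1, 1:]) (real m)"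
    by (subst (asm) eventually_sequentially_Suc)
  then show "eventually_poly f" unfolding eventually_poly_def by blast
next
  assume "eventually_poly f"
  then obtain p where "\<forall>\<^sub>F m in sequentially. real (f m) = poly p (real m)"
    unfolding eventually_poly_def by blast
  then have "\<forall>\<^sub>F m in sequentially. real (f (Suc m)) = poly p (real (Suc m))"
    by (subst eventually_sequentially_Suc)
  then have "\<forall>\<^sub>F m in sequentially. real (f (Suc m)) = poly (p \<circ>\<^sub>p [:1, 1:]) (real m)"
    by eventually_elim (simp add: poly_pcompose add.commute)
  then show "eventually_poly (\<lambda>m. f (Suc m))" unfolding eventually_poly_def by blast
qed

text \<open>From some point on, \<open>f\<close> differs from an antidifference of the polynomial
  for \<open>g\<close> by a constant.\<close>

lemma eventually_poly_of_increment:
  assumes "eventually_poly g" and f: "\<And>m. f (Suc m) = f m + g m"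
  shows "eventually_poly f"
proof -
  from assms(1) obtain q M where q: "real (g m) = poly q (real m)" if "m \<ge> M" for m
    unfolding eventually_poly_def eventually_sequentially by blast
  obtain p :: "real poly" where p: "poly p (x + 1) - poly p x = poly q x" for x
    using poly_antidifference by blast
  \<comment> \<open>The constant of summation, fixed at \<open>M\<close> because the formula for
    \<open>g\<close> is known only from there on.\<close>
  define c where "c = real (f M) - poly p (real M)"
  have "real (f m) = poly (p + [:c:]) (real m)" if "m \<ge> M" for m
    using that
  proof (induction m rule: dec_induct)
    case base
    then show ?case by (simp add: c_def)
  next
    case (step m)
    then show ?case using p[of "real m"] q[of m] by (simp add: f add.commute)
  qed
  then show ?thesis
    unfolding eventually_poly_def eventually_sequentially by blast
qed

text \<open>Here \<open>m\<close> counts steps, so a walk lists \<open>Suc m\<close> vertices and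
  \<open>hd\<close> and \<open>last\<close> are always meaningful.\<close>

definition walks :: "'a set \<Rightarrow> ('a \<Rightarrow> 'a \<Rightarrow> bool) \<Rightarrow> nat \<Rightarrow> 'a \<Rightarrow> 'a \<Rightarrow> 'a list set" where
  "walks X T m x y =
     {xs. length xs = Suc m \<and> set xs \<subseteq> X \<and> successively T xs \<and> hd xs = x \<and> last xs = y}"

lemma finite_walks: "finite X \<Longrightarrow> finite (walks X T m x y)"
  by (rule finite_subset[OF _ finite_lists_length_eq[of X "Suc m"]]) (auto simp: walks_def)

lemma walks_Suc:
  assumes "x \<in> X"
  shows "walks X T (Suc m) x y = (\<Union>z\<in>{z \<in> X. T x z}. (#) x ` walks X T m z y)"
proof (intro set_eqI iffI)
  fix xs assume xs: "xs \<in> walks X T (Suc m) x y"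
  then obtain ys where ys: "xs = x # ys" "length ys = Suc m"
    by (cases xs) (auto simp: walks_def)
  then obtain z zs where "ys = z # zs" by (cases ys) auto
  with xs ys show "xs \<in> (\<Union>z\<in>{z \<in> X. T x z}. (#) x ` walks X T m z y)"
    by (auto simp: walks_def)
next
  fix xs assume "xs \<in> (\<Union>z\<in>{z \<in> X. T x z}. (#) x ` walks X T m z y)"
  then obtain z ys where "T x z" "xs = x # ys" "ys \<in> walks X T m z y" by auto
  with assms show "xs \<in> walks X T (Suc m) x y"
    by (cases ys) (auto simp: walks_def)
qed

lemma card_walks_Suc:
  assumes "finite X" "x \<in> X"
  shows "card (walks X T (Suc m) x y) = (\<Sum>z\<in>{z \<in> X. T x z}. card (walks X T m z y))"
proof -
  have "card (walks X T (Suc m) x y) = (\<Sum>z\<in>{z \<in> X. T x z}. card ((#) x ` walks X T m z y))"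
    unfolding walks_Suc[OF assms(2)]
    by (rule card_UN_disjoint) (use assms in \<open>auto simp: finite_walks, auto simp: walks_def\<close>)
  then show ?thesis
    by (simp add: card_image)
qed

text \<open>Every edge other than a loop raises \<open>rk\<close>, so induction on the distance of
  \<open>rk x\<close> from the maximal rank settles all proper successors of \<open>x\<close>. With
  a loop at \<open>x\<close> their walks make up the increment of the count; without one, the count
  is their sum, shifted by one step.\<close>

lemma eventually_poly_card_walks:
  fixes rk :: "'a \<Rightarrow> nat"
  assumes "finite X" and rk: "\<And>x y. x \<in> X \<Longrightarrow> y \<in> X \<Longrightarrow> T x y \<Longrightarrow> x \<noteq> y \<Longrightarrow> rk x < rk y"
    and "x \<in> X"
  shows "eventually_poly (\<lambda>m. card (walks X T m x y))"
  using \<open>x \<in> X\<close>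
proof (induction "Max (rk ` X) - rk x" arbitrary: x rule: less_induct)
  case less
  define S where "S = {z \<in> X. T x z \<and> z \<noteq> x}"
  have "finite S" using \<open>finite X\<close> by (simp add: S_def)
  have "eventually_poly (\<lambda>m. card (walks X T m z y))" if "z \<in> S" for z
  proof (rule less.hyps)
    have "rk x < rk z" "z \<in> X" using that rk less.prems by (auto simp: S_def)
    moreover have "rk z \<le> Max (rk ` X)" using \<open>z \<in> X\<close> \<open>finite X\<close> by simp
    ultimately show "Max (rk ` X) - rk z < Max (rk ` X) - rk x" "z \<in> X" by auto
  qed
  then have sum: "eventually_poly (\<lambda>m. \<Sum>z\<in>S. card (walks X T m z y))"
    by (rule eventually_poly_sum)
  show ?case
  proof (cases "T x x")
    case True
    then have "{z \<in> X. T x z} = insert x S" using less.prems by (auto simp: S_def)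
    then have "card (walks X T (Suc m) x y)
        = card (walks X T m x y) + (\<Sum>z\<in>S. card (walks X T m z y))" for m
      using \<open>finite S\<close> by (simp add: card_walks_Suc[OF \<open>finite X\<close> less.prems] S_def)
    then show ?thesis by (rule eventually_poly_of_increment[OF sum])
  next
    case False
    then have "{z \<in> X. T x z} = S" by (auto simp: S_def)
    then have "card (walks X T (Suc m) x y) = (\<Sum>z\<in>S. card (walks X T m z y))" for m
      by (simp add: card_walks_Suc[OF \<open>finite X\<close> less.prems])
    then show ?thesis using sum by (subst eventually_poly_Suc_iff[symmetric]) simp
  qed
qed

text \<open>Sorting by the two ends of the walk makes the count a combination of the counts of
  \<open>walks\<close>, with the number of fitting marks as constant weights. The shift to
  \<open>Suc m\<close> turns lengths into numbers of steps and avoids the ends of an empty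
  list.\<close>

lemma eventually_poly_card_marked_walks:
  fixes rk :: "'a \<Rightarrow> nat"
  assumes "finite X" "finite Z"
    and "\<And>x y. x \<in> X \<Longrightarrow> y \<in> X \<Longrightarrow> T x y \<Longrightarrow> x \<noteq> y \<Longrightarrow> rk x < rk y"
  shows "eventually_poly (\<lambda>m. card {(xs, z). length xs = m \<and> set xs \<subseteq> X \<and> successively T xs
            \<and> z \<in> Z \<and> Q (hd xs) (last xs) z})" (is "eventually_poly (\<lambda>m. card (?M m))")
proof (subst eventually_poly_Suc_iff[symmetric])
  have "card (?M (Suc m))
      = (\<Sum>x\<in>X. \<Sum>y\<in>X. card (walks X T m x y) * card {z \<in> Z. Q x y z})" for m
  proof -
    have "?M (Suc m) = (\<Union>x\<in>X. \<Union>y\<in>X. walks X T m x y \<times> {z \<in> Z. Q x y z})"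
    proof (intro set_eqI iffI)
      fix w assume w: "w \<in> ?M (Suc m)"
      obtain xs z where [simp]: "w = (xs, z)" by (cases w)
      have "hd xs \<in> X" "last xs \<in> X" using w by (auto simp: length_Suc_conv)
      then show "w \<in> (\<Union>x\<in>X. \<Union>y\<in>X. walks X T m x y \<times> {z \<in> Z. Q x y z})"
        using w by (auto simp: walks_def)
    qed (auto simp: walks_def)
    also have "card \<dots> = (\<Sum>x\<in>X. card (\<Union>y\<in>X. walks X T m x y \<times> {z \<in> Z. Q x y z}))"
      by (rule card_UN_disjoint) (use assms in \<open>auto simp: finite_walks, auto simp: walks_def\<close>)
    also have "\<dots> = (\<Sum>x\<in>X. \<Sum>y\<in>X. card (walks X T m x y \<times> {z \<in> Z. Q x y z}))"
      by (intro sum.cong refl card_UN_disjoint)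
        (use assms in \<open>auto simp: finite_walks, auto simp: walks_def\<close>)
    finally show ?thesis by (simp add: card_cartesian_product)
  qed
  moreover have "eventually_poly
      (\<lambda>m. \<Sum>x\<in>X. \<Sum>y\<in>X. card (walks X T m x y) * card {z \<in> Z. Q x y z})"
    by (intro eventually_poly_sum eventually_poly_cmult eventually_poly_card_walks assms)
      (use assms in auto)
  ultimately show "eventually_poly (\<lambda>m. card (?M (Suc m)))" by simp
qed

subsection \<open>Young diagrams and their level counts\<close>

locale weights =
  fixes A B :: nat
  assumes A_pos: "A > 0" and B_pos: "B > 0" and coprime_AB: "coprime A B"
begin

definition level :: "nat \<times> nat \<Rightarrow> int" where
  "level x = int A * int (fst x) - int B * int (snd x)"

text \<open>The boxes of a fixed level form a chain with steps \<open>(B, A)\<close>; \<open>depth\<close> is the position in it.\<close>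

definition depth :: "nat \<times> nat \<Rightarrow> nat" where
  "depth x = min (fst x div B) (snd x div A)"

definition level_count :: "(nat \<times> nat) set \<Rightarrow> int \<Rightarrow> nat" where
  "level_count lam c = card {x \<in> lam. level x = c}"

definition diagram_of :: "(int \<Rightarrow> nat) \<Rightarrow> (nat \<times> nat) set" where
  "diagram_of N = {x. depth x < N (level x)}"

text \<open>
  Moving a box one step left or down lowers its level by \<open>A\<close> or raises it by \<open>B\<close>. The extra \<open>1\<close>
  accounts for the levels that contain a box \<open>(0, j)\<close> or \<open>(i, 0)\<close>, which has no such neighbour.
\<close>

definition admissible_at :: "(int \<Rightarrow> nat) \<Rightarrow> int \<Rightarrow> bool" where
  "admissible_at N c \<longleftrightarrow> N c \<le> N (c - int A) + of_bool (c \<le> 0 \<and> int B dvd c)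
     \<and> N (c - int B) \<le> N c + of_bool (c \<ge> int B \<and> int A dvd c - int B)"

text \<open>Equal levels give \<open>A * (i' - i) = B * (j' - j)\<close>, and coprimality makes
  \<open>i' - i\<close> a multiple of \<open>B\<close>.\<close>

lemma level_eqE:
  assumes "level (i, j) = level (i', j')" "i \<le> i'"
  obtains q where "i' = i + B * q" "j' = j + A * q"
proof -
  from assms(1) have eq: "int A * (int i' - int i) = int B * (int j' - int j)"
    by (simp add: level_def algebra_simps)
  then have "int B dvd int A * (int i' - int i)" by simp
  then have "int B dvd int i' - int i"
    using coprime_AB by (simp add: coprime_dvd_mult_right_iff coprime_commute)
  then have "int B dvd int (i' - i)" using assms(2) by (simp add: of_nat_diff)
  then have "B dvd i' - i" by (simp only: int_dvd_int_iff)
  then obtain q where "i' - i = B * q" ..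
  with assms(2) have q: "i' = i + B * q" by simp
  with eq have "int B * (int A * int q) = int B * (int j' - int j)" by (simp add: ac_simps)
  then have "int j' = int (j + A * q)" using B_pos by simp
  then have "j' = j + A * q" by (simp only: of_nat_eq_iff)
  with q show ?thesis using that by blast
qed

lemma depth_shift: "depth (i + B * q, j + A * q) = depth (i, j) + q"
  using A_pos B_pos by (simp add: depth_def)

lemma level_depth_le_iff:
  assumes "level x = level y"
  shows "depth x \<le> depth y \<longleftrightarrow> fst x \<le> fst y \<and> snd x \<le> snd y"
proof -
  obtain i j where x: "x = (i, j)" by (cases x)
  obtain i' j' where y: "y = (i', j')" by (cases y)
  show ?thesis
  proof (cases "i \<le> i'")
    case True
    with assms obtain q where "i' = i + B * q" "j' = j + A * q" unfolding x y by (rule level_eqE)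
    then show ?thesis by (simp add: x y depth_shift)
  next
    case False
    with assms[symmetric] obtain q where q: "i = i' + B * q" "j = j' + A * q"
      unfolding x y by (auto elim: level_eqE)
    then have "q > 0" using False by (auto intro!: Nat.gr0I)
    with q show ?thesis using B_pos A_pos by (auto simp: x y depth_shift)
  qed
qed

lemma inj_on_depth: "inj_on depth {x. level x = c}"
proof (rule inj_onI)
  fix x y assume "x \<in> {x. level x = c}" "y \<in> {x. level x = c}" "depth x = depth y"
  then show "x = y" using level_depth_le_iff[of x y] level_depth_le_iff[of y x]
    by (auto intro!: prod_eqI)
qed

text \<open>Bezout coefficients give an integer point of level \<open>c\<close>, and a large
  multiple of the step \<open>(B, A)\<close> moves it into the quadrant. Going down the chain to
  depth 0 and then up \<open>q\<close> steps reaches the required box.\<close>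

lemma depth_surj: "\<exists>x. level x = c \<and> depth x = q"
proof -
  obtain u v :: int where uv: "int A * u + int B * v = 1"
    using bezout_int[of "int A" "int B"] coprime_AB by (auto simp: mult.commute)
  define M where "M = \<bar>c * u\<bar> + \<bar>c * v\<bar>"
  define i where "i = nat (c * u + int B * M)"
  define j where "j = nat (int A * M - c * v)"
  have M: "M \<ge> 0" "c * u + M \<ge> 0" "M - c * v \<ge> 0" by (auto simp: M_def)
  have "1 * M \<le> int B * M" "1 * M \<le> int A * M"
    using M(1) A_pos B_pos by (intro mult_right_mono; simp)+
  with M have ij: "int i = c * u + int B * M" "int j = int A * M - c * v"
    by (simp_all add: i_def j_def)
  have "level (i, j) = c * (int A * u + int B * v)"
    by (simp add: level_def ij algebra_simps)
  then have lev: "level (i, j) = c" by (simp add: uv)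
  define d where "d = depth (i, j)"
  have d: "B * d \<le> i" "A * d \<le> j"
  proof -
    have "B * d \<le> B * (i div B)" "A * d \<le> A * (j div A)" by (simp_all add: d_def depth_def)
    then show "B * d \<le> i" "A * d \<le> j"
      by (meson order.trans times_div_less_eq_dividend)+
  qed
  define x where "x = (i - B * d + B * q, j - A * d + A * q)"
  have "level x = c"
    using lev d by (simp add: x_def level_def of_nat_diff algebra_simps)
  moreover have "depth (i - B * d, j - A * d) + d = d"
    using depth_shift[of "i - B * d" d "j - A * d"] d by (simp add: d_def)
  then have "depth x = q" by (simp add: x_def depth_shift)
  ultimately show ?thesis by blast
qed

lemma depth_image: "depth ` {x. level x = c \<and> depth x < q} = {..<q}"
proof (intro set_eqI iffI)
  fix d assume d: "d \<in> {..<q}"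
  obtain x where "level x = c" "depth x = d" using depth_surj by blast
  with d show "d \<in> depth ` {x. level x = c \<and> depth x < q}" by auto
qed auto

lemma level_count_diagram_of: "level_count (diagram_of N) = N"
proof
  fix c
  have "{x \<in> diagram_of N. level x = c} = {x. level x = c \<and> depth x < N c}"
    by (auto simp: diagram_of_def)
  moreover have "card (depth ` {x. level x = c \<and> depth x < N c}) = card {x. level x = c \<and> depth x < N c}"
    by (rule card_image, rule inj_on_subset[OF inj_on_depth[of c]]) auto
  ultimately show "level_count (diagram_of N) c = N c"
    by (simp add: level_count_def depth_image)
qed

lemma young_diagramD:
  "young_diagram lam \<Longrightarrow> (i, j) \<in> lam \<Longrightarrow> i' \<le> i \<Longrightarrow> j' \<le> j \<Longrightarrow> (i', j') \<in> lam"
  unfolding young_diagram_def by blast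

text \<open>On one level, smaller depth means componentwise smaller coordinates. So the depths of
  the boxes of a Young diagram on that level are closed downwards and form the initial segment given
  by their number.\<close>

lemma diagram_of_level_count:
  assumes "young_diagram lam"
  shows "diagram_of (level_count lam) = lam"
proof -
  have fin: "finite lam" using assms by (simp add: young_diagram_def)
  have "depth x < level_count lam (level x) \<longleftrightarrow> x \<in> lam" for x
  proof -
    define c where "c = level x"
    define D where "D = depth ` {x \<in> lam. level x = c}"
    have cD: "card D = level_count lam c"
      unfolding D_def level_count_def
      by (rule card_image, rule inj_on_subset[OF inj_on_depth[of c]]) auto
    have finD: "finite D" using fin by (simp add: D_def)
    have xD: "depth x \<in> D \<longleftrightarrow> x \<in> lam"
    proof
      assume "depth x \<in> D"
      then obtain y where y: "y \<in> lam" "level y = c" "depth y = depth x" by (auto simp: D_def)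
      then have "y = x" using inj_onD[OF inj_on_depth[of c], of y x] by (simp add: c_def)
      with y show "x \<in> lam" by simp
    qed (auto simp: D_def c_def)
    have down: "q' \<in> D" if "q \<in> D" "q' \<le> q" for q q'
    proof -
      obtain y where y: "y \<in> lam" "level y = c" "depth y = q"
        using \<open>q \<in> D\<close> unfolding D_def by blast
      obtain z where z: "level z = c" "depth z = q'" using depth_surj by blast
      have "fst z \<le> fst y \<and> snd z \<le> snd y"
        using y z that level_depth_le_iff[of z y] by simp
      then have "z \<in> lam" using young_diagramD[OF assms, of "fst y" "snd y" "fst z" "snd z"] y(1) by simp
      with z show ?thesis by (auto simp: D_def)
    qed
    have "depth x < card D \<longleftrightarrow> depth x \<in> D"
    proof
      assume "depth x \<in> D"
      then have "{..depth x} \<subseteq> D" using down by auto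
      then have "card {..depth x} \<le> card D" using finD by (rule card_mono[rotated])
      then show "depth x < card D" by simp
    next
      assume *: "depth x < card D"
      show "depth x \<in> D"
      proof (rule ccontr)
        assume "depth x \<notin> D"
        then have "D \<subseteq> {..<depth x}" using down by (meson lessThan_iff not_less subsetI)
        then have "card D \<le> card {..<depth x}" by (rule card_mono[rotated]) simp
        with * show False by simp
      qed
    qed
    then show ?thesis using xD cD by (simp add: c_def)
  qed
  then show ?thesis by (auto simp: diagram_of_def)
qed

lemma card_le_add_if_inj_on_Diff:
  assumes "finite Y" "inj_on f (X - S)" "f ` (X - S) \<subseteq> Y" "finite S" "card S \<le> d"
  shows "card X \<le> card Y + d"
proof -
  have "card (X - S) \<le> card Y" using assms by (meson card_inj_on_le)
  then show ?thesis using diff_card_le_card_Diff[OF \<open>finite S\<close>, of X] assms(5) by linarith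
qed

text \<open>Moving left is injective from level \<open>c\<close> to level \<open>c - A\<close>, and
  moving down from level \<open>c - B\<close> to level \<open>c\<close>. Only a box on the border
  has no image; a level contains at most one box of each border, and only when the condition inside
  \<open>of_bool\<close> holds.\<close>

lemma admissible_level_count:
  assumes "young_diagram lam"
  shows "admissible_at (level_count lam) c"
proof -
  have fin: "finite lam" using assms by (simp add: young_diagram_def)
  define S where "S = {x. level x = c \<and> fst x = 0}"
  have S: "finite S \<and> card S \<le> of_bool (c \<le> 0 \<and> int B dvd c)"
  proof (cases "c \<le> 0 \<and> int B dvd c")
    case True
    have "S \<subseteq> {(0, nat (- c div int B))}"
      using B_pos by (auto simp: S_def level_def)
    then show ?thesis using True card_mono[of "{(0::nat, nat (- c div int B))}" S]
      by (auto intro: finite_subset)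
  next
    case False
    have "c \<le> 0 \<and> int B dvd c" if "x \<in> S" for x
    proof -
      have "c = - (int B * int (snd x))" using that by (auto simp: S_def level_def)
      then show ?thesis by simp
    qed
    with False have "S = {}" by blast
    then show ?thesis by simp
  qed
  have 1: "level_count lam c \<le> level_count lam (c - int A) + of_bool (c \<le> 0 \<and> int B dvd c)"
    unfolding level_count_def
  proof (rule card_le_add_if_inj_on_Diff[where S = S and f = "\<lambda>x. (fst x - 1, snd x)"])
    show "inj_on (\<lambda>x. (fst x - 1, snd x)) ({x \<in> lam. level x = c} - S)"
      by (auto simp: inj_on_def S_def)
    show "(\<lambda>x. (fst x - 1, snd x)) ` ({x \<in> lam. level x = c} - S)
        \<subseteq> {x \<in> lam. level x = c - int A}"
      by (auto simp: S_def level_def of_nat_diff algebra_simps intro: young_diagramD[OF assms])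
  qed (use fin S in auto)
  define S' where "S' = {x. level x = c - int B \<and> snd x = 0}"
  have S': "finite S' \<and> card S' \<le> of_bool (c \<ge> int B \<and> int A dvd c - int B)"
  proof (cases "c \<ge> int B \<and> int A dvd c - int B")
    case True
    have "S' \<subseteq> {(nat ((c - int B) div int A), 0)}"
    proof
      fix x assume "x \<in> S'"
      then have "c - int B = int A * int (fst x)" "snd x = 0" by (auto simp: S'_def level_def)
      then show "x \<in> {(nat ((c - int B) div int A), 0)}"
        using A_pos by (auto intro!: prod_eqI)
    qed
    then show ?thesis using True card_mono[of "{(nat ((c - int B) div int A), 0)}" S']
      by (auto intro: finite_subset)
  next
    case False
    have "S' = {}"
    proof (rule ccontr)
      assume "S' \<noteq> {}"
      then obtain i where "int A * int i = c - int B" by (auto simp: S'_def level_def)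
      then have "c - int B \<ge> 0 \<and> int A dvd c - int B"
        by (metis dvd_triv_left of_nat_0_le_iff zero_le_mult_iff)
      with False show False by simp
    qed
    then show ?thesis by simp
  qed
  have 2: "level_count lam (c - int B) \<le> level_count lam c + of_bool (c \<ge> int B \<and> int A dvd c - int B)"
    unfolding level_count_def
  proof (rule card_le_add_if_inj_on_Diff[where S = S' and f = "\<lambda>x. (fst x, snd x - 1)"])
    show "inj_on (\<lambda>x. (fst x, snd x - 1)) ({x \<in> lam. level x = c - int B} - S')"
      by (auto simp: inj_on_def S'_def)
    show "(\<lambda>x. (fst x, snd x - 1)) ` ({x \<in> lam. level x = c - int B} - S')
        \<subseteq> {x \<in> lam. level x = c}"
      by (auto simp: S'_def level_def of_nat_diff algebra_simps intro: young_diagramD[OF assms])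
  qed (use fin S' in auto)
  from 1 2 show ?thesis by (simp add: admissible_at_def)
qed

text \<open>Moving left never increases the depth, which suffices when the inequality has no extra
  1. When it has one, \<open>Suc i\<close> is a multiple \<open>B * q\<close> and the first
  coordinate determines the depth \<open>q\<close>, so moving left lowers the depth and makes up for
  the 1. Moving down is the mirror image, with \<open>Suc j = A * q\<close>.\<close>

lemma diagram_of_step_left:
  assumes "admissible_at N (level (Suc i, j))" "(Suc i, j) \<in> diagram_of N"
  shows "(i, j) \<in> diagram_of N"
proof -
  define c where "c = level (Suc i, j)"
  have c': "level (i, j) = c - int A" by (simp add: c_def level_def algebra_simps)
  have d: "depth (Suc i, j) < N c" using assms(2) by (simp add: diagram_of_def c_def)
  have adm: "N c \<le> N (c - int A) + of_bool (c \<le> 0 \<and> int B dvd c)"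
    using assms(1) by (simp add: admissible_at_def c_def)
  have "depth (i, j) < N (c - int A)"
  proof (cases "c \<le> 0 \<and> int B dvd c")
    case False
    have "depth (i, j) \<le> depth (Suc i, j)" 
      unfolding depth_def fst_conv snd_conv by (intro min.mono div_le_mono) auto
    with False d adm show ?thesis by auto
  next
    case True
    then have "int B dvd int A * int (Suc i)"
      unfolding c_def level_def by (auto simp: dvd_diff_left_iff)
    then have "B dvd Suc i"
      using coprime_AB by (simp add: coprime_dvd_mult_right_iff coprime_commute del: of_nat_Suc)
    then obtain q where q: "Suc i = B * q" ..
    have "int (A * Suc i) \<le> int (B * j)" using True unfolding c_def level_def by (simp add: algebra_simps)
    then have "A * (B * q) \<le> B * j" unfolding q by linarith
    then have "B * (A * q) \<le> B * j" by (simp add: ac_simps)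
    then have "A * q \<le> j" using B_pos by simp
    then have "q \<le> j div A" using A_pos by (simp add: less_eq_div_iff_mult_less_eq mult.commute)
    then have dq: "depth (Suc i, j) = q" using q B_pos by (simp add: depth_def)
    have "i < B * q" using q by simp
    then have "i div B < q" by (simp add: less_mult_imp_div_less mult.commute)
    then have "depth (i, j) < q" by (simp add: depth_def)
    with dq d adm True show ?thesis by auto
  qed
  then show ?thesis by (simp add: diagram_of_def c')
qed

lemma diagram_of_step_down:
  assumes "admissible_at N (level (i, j))" "(i, Suc j) \<in> diagram_of N"
  shows "(i, j) \<in> diagram_of N"
proof -
  define c where "c = level (i, j)"
  have c': "level (i, Suc j) = c - int B" by (simp add: c_def level_def algebra_simps)
  have d: "depth (i, Suc j) < N (c - int B)" using assms(2) by (simp add: diagram_of_def c')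
  have adm: "N (c - int B) \<le> N c + of_bool (c \<ge> int B \<and> int A dvd c - int B)"
    using assms(1) by (simp add: admissible_at_def c_def)
  have "depth (i, j) < N c"
  proof (cases "c \<ge> int B \<and> int A dvd c - int B")
    case False
    have "depth (i, j) \<le> depth (i, Suc j)" 
      unfolding depth_def fst_conv snd_conv by (intro min.mono div_le_mono) auto
    with False d adm show ?thesis by auto
  next
    case True
    then have "int A dvd int A * int i - int B * int (Suc j)"
      unfolding c'[symmetric] level_def by simp
    then have "int A dvd int B * int (Suc j)"
      by (simp add: dvd_diff_right_iff)
    then have "A dvd Suc j"
      using coprime_AB by (simp add: coprime_dvd_mult_right_iff del: of_nat_Suc)
    then obtain q where q: "Suc j = A * q" ..
    have "int (B * Suc j) \<le> int (A * i)" using True unfolding c_def level_def by (simp add: algebra_simps)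
    then have "B * (A * q) \<le> A * i" unfolding q by linarith
    then have "A * (B * q) \<le> A * i" by (simp add: ac_simps)
    then have "B * q \<le> i" using A_pos by simp
    then have "q \<le> i div B" using B_pos by (simp add: less_eq_div_iff_mult_less_eq mult.commute)
    then have dq: "depth (i, Suc j) = q" using q A_pos by (simp add: depth_def)
    have "j < A * q" using q by simp
    then have "j div A < q" by (simp add: less_mult_imp_div_less mult.commute)
    then have "depth (i, j) < q" by (simp add: depth_def)
    with dq d adm True show ?thesis by auto
  qed
  then show ?thesis by (simp add: diagram_of_def c_def)
qed

lemma young_diagram_of:
  assumes "\<And>c. admissible_at N c" and fin: "finite {c. N c \<noteq> 0}"
  shows "young_diagram (diagram_of N)"
  unfolding young_diagram_def
proof (intro conjI allI impI)
  have "diagram_of N \<subseteq> (\<Union>c\<in>{c. N c \<noteq> 0}. {x. level x = c \<and> depth x < N c})"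
    by (auto simp: diagram_of_def)
  moreover have "finite {x. level x = c \<and> depth x < N c}" for c
    by (rule finite_imageD[where f = depth])
      (simp add: depth_image, rule inj_on_subset[OF inj_on_depth[of c]], auto)
  ultimately show "finite (diagram_of N)" using fin by (auto intro: finite_subset)
  have left: "(i - p, j) \<in> diagram_of N" if "(i, j) \<in> diagram_of N" for i j p
  proof (induction p)
    case (Suc p)
    then show ?case using diagram_of_step_left[OF assms(1), of "i - Suc p" j]
      by (cases "p < i") (auto simp: Suc_diff_Suc)
  qed (use that in auto)
  have down: "(i, j - p) \<in> diagram_of N" if "(i, j) \<in> diagram_of N" for i j p
  proof (induction p)
    case (Suc p)
    then show ?case using diagram_of_step_down[OF assms(1), of i "j - Suc p"]
      by (cases "p < j") (auto simp: Suc_diff_Suc)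
  qed (use that in auto)
  fix i j i' j' assume *: "(i, j) \<in> diagram_of N \<and> i' \<le> i \<and> j' \<le> j"
  then have "(i - (i - i'), j - (j - j')) \<in> diagram_of N" using left down by blast
  with * show "(i', j') \<in> diagram_of N" by simp
qed


text \<open>The lowest row is needed only for the blocks \<open>U\<close> and \<open>V\<close> of \<open>seam\<close>, which run past column \<open>n\<close>.\<close>

definition rows :: "nat \<Rightarrow> int set" where
  "rows r = {- int (r * (A + B)) - 1 ..< int (r * (A + B)) + 1}"

text \<open>The level counts of balanced diagrams, described without the diagrams. Rows are indexed
  by \<open>c div n\<close> and columns by \<open>c mod n\<close>, so that the column sums express
  balance.\<close>

definition profiles :: "nat \<Rightarrow> nat \<Rightarrow> (int \<Rightarrow> nat) set" where
  "profiles r n = {N. (\<forall>c. admissible_at N c) \<and> (\<forall>c. N c \<noteq> 0 \<longrightarrow> c div int n \<in> rows r)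
     \<and> (\<forall>t<n. (\<Sum>k\<in>rows r. N (k * int n + int t)) = r)}"

section \<open>Balanced diagrams and their profiles\<close>

lemma box_color_eq_level: "box_color (int A) (- int B) n x = level x mod int n"
  by (simp add: box_color_def level_def)

text \<open>Pigeonhole: the indices \<open>0, ..., r\<close> would give \<open>r + 1\<close>
  distinct boxes of one color.\<close>

lemma balanced_not_many_same_color:
  assumes lam: "lam \<in> balanced_partitions r a b n" and "n > 0"
    and inj: "inj_on f {..r}" and f: "\<And>k. k \<le> r \<Longrightarrow> f k \<in> lam"
    and col: "\<And>k. k \<le> r \<Longrightarrow> box_color a b n (f k) = c"
  shows False
proof -
  have "c = box_color a b n (f 0)" using col by simp
  then have "c \<in> {0..<int n}" using \<open>n > 0\<close> by (simp add: box_color_def)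
  then have "card {x \<in> lam. box_color a b n x = c} = r"
    using lam by (simp add: balanced_partitions_def balanced_def)
  moreover have "finite lam"
    using lam by (simp add: balanced_partitions_def young_diagram_def)
  ultimately have "card (f ` {..r}) \<le> r"
    using card_mono[of "{x \<in> lam. box_color a b n x = c}" "f ` {..r}"] f col by auto
  then show False using inj by (simp add: card_image)
qed

text \<open>Steps of length \<open>n\<close> along a row or a column keep the color, and a box too
  far out would have \<open>r\<close> such steps available inside the diagram.\<close>

lemma balanced_box_bounds:
  assumes lam: "lam \<in> balanced_partitions r (int A) (- int B) n" and "n > 0" and x: "(i, j) \<in> lam"
  shows "i < r * n" "j < r * n"
proof -
  have young: "young_diagram lam" using lam by (simp add: balanced_partitions_def)
  show "i < r * n"
  proof (rule ccontr)
    assume "\<not> i < r * n"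
    then have le: "k * n \<le> i" if "k \<le> r" for k
      using mult_le_mono1[OF that, of n] by linarith
    show False
    proof (rule balanced_not_many_same_color[OF lam \<open>n > 0\<close>])
      show "inj_on (\<lambda>k. (i - k * n, j)) {..r}"
      proof (rule inj_onI)
        fix x y assume "x \<in> {..r}" "y \<in> {..r}" and eq: "(i - x * n, j) = (i - y * n, j)"
        then have "x * n \<le> i" "y * n \<le> i" by (simp_all add: le)
        moreover have "i - x * n = i - y * n" using eq by simp
        ultimately have "x * n = y * n" by linarith
        then show "x = y" using \<open>n > 0\<close> by simp
      qed
      show "(i - k * n, j) \<in> lam" if "k \<le> r" for k
        by (rule young_diagramD[OF young x]) auto
      show "box_color (int A) (- int B) n (i - k * n, j) = level (i, j) mod int n" if "k \<le> r" for k
      proof -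
        have "level (i - k * n, j) = level (i, j) + int n * (- int A * int k)"
          using le[OF that] by (simp add: level_def of_nat_diff algebra_simps)
        then show ?thesis unfolding box_color_eq_level by (simp only: mod_mult_self2)
      qed
    qed
  qed
  show "j < r * n"
  proof (rule ccontr)
    assume "\<not> j < r * n"
    then have le: "k * n \<le> j" if "k \<le> r" for k
      using mult_le_mono1[OF that, of n] by linarith
    show False
    proof (rule balanced_not_many_same_color[OF lam \<open>n > 0\<close>])
      show "inj_on (\<lambda>k. (i, j - k * n)) {..r}"
      proof (rule inj_onI)
        fix x y assume "x \<in> {..r}" "y \<in> {..r}" and eq: "(i, j - x * n) = (i, j - y * n)"
        then have "x * n \<le> j" "y * n \<le> j" by (simp_all add: le)
        moreover have "j - x * n = j - y * n" using eq by simp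
        ultimately have "x * n = y * n" by linarith
        then show "x = y" using \<open>n > 0\<close> by simp
      qed
      show "(i, j - k * n) \<in> lam" if "k \<le> r" for k
        by (rule young_diagramD[OF young x]) auto
      show "box_color (int A) (- int B) n (i, j - k * n) = level (i, j) mod int n" if "k \<le> r" for k
      proof -
        have "level (i, j - k * n) = level (i, j) + int n * (int B * int k)"
          using le[OF that] by (simp add: level_def of_nat_diff algebra_simps)
        then show ?thesis unfolding box_color_eq_level by (simp only: mod_mult_self2)
      qed
    qed
  qed
qed

lemma balanced_level_bounds:
  assumes lam: "lam \<in> balanced_partitions r (int A) (- int B) n" and "n > 0" and x: "x \<in> lam"
  shows "- int (r * (A + B)) * int n \<le> level x" "level x < int (r * (A + B)) * int n"
proof -
  obtain i j where ij: "x = (i, j)" by (cases x)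
  have b: "i < r * n" "j < r * n"
    using balanced_box_bounds[OF lam \<open>n > 0\<close>] x ij by auto
  have "int (A * i) < int (A * (r * n))" "int (B * j) < int (B * (r * n))"
    using b A_pos B_pos by (simp_all only: of_nat_less_iff nat_mult_less_cancel_disj)
  moreover have "int (r * (A + B)) * int n = int (A * (r * n)) + int (B * (r * n))"
    by (simp add: algebra_simps)
  moreover have "level x = int (A * i) - int (B * j)" by (simp add: ij level_def)
  moreover have "int (A * i) \<ge> 0" "int (B * j) \<ge> 0" by simp_all
  ultimately show "- int (r * (A + B)) * int n \<le> level x" "level x < int (r * (A + B)) * int n"
    unfolding mult_minus_left by linarith+
qed

lemma card_color_eq_sum:
  assumes "finite lam" and t: "t < n" and K: "finite K" "\<And>x. x \<in> lam \<Longrightarrow> level x div int n \<in> K"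
  shows "card {x \<in> lam. box_color (int A) (- int B) n x = int t}
    = (\<Sum>k\<in>K. level_count lam (k * int n + int t))"
proof -
  have "{x \<in> lam. box_color (int A) (- int B) n x = int t}
      = (\<Union>k\<in>K. {x \<in> lam. level x = k * int n + int t})"
  proof (intro set_eqI iffI)
    fix x assume "x \<in> {x \<in> lam. box_color (int A) (- int B) n x = int t}"
    then have "x \<in> lam" "level x mod int n = int t" by (auto simp: box_color_eq_level)
    moreover have "level x = (level x div int n) * int n + level x mod int n" by simp
    ultimately show "x \<in> (\<Union>k\<in>K. {x \<in> lam. level x = k * int n + int t})"
      using K(2)[of x] by auto
  qed (use t in \<open>auto simp: box_color_eq_level\<close>)
  also have "card \<dots> = (\<Sum>k\<in>K. card {x \<in> lam. level x = k * int n + int t})"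
    by (rule card_UN_disjoint) (use assms in auto)
  finally show ?thesis by (simp add: level_count_def)
qed

lemma finite_rows: "finite (rows r)"
  by (simp add: rows_def)

lemma level_count_in_profiles:
  assumes lam: "lam \<in> balanced_partitions r (int A) (- int B) n" and n: "n > 0"
  shows "level_count lam \<in> profiles r n"
proof -
  have young: "young_diagram lam" using lam by (simp add: balanced_partitions_def)
  then have fin: "finite lam" by (simp add: young_diagram_def)
  have rows: "level x div int n \<in> rows r" if "x \<in> lam" for x
  proof -
    have "- int (r * (A + B)) \<le> level x div int n"
    proof -
      have "- int (r * (A + B)) = (- int (r * (A + B)) * int n) div int n"
        using n by (subst nonzero_mult_div_cancel_right) auto
      also have "\<dots> \<le> level x div int n"
        using balanced_level_bounds(1)[OF lam n that] n by (intro zdiv_mono1) auto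
      finally show ?thesis .
    qed
    moreover have "level x div int n < int (r * (A + B))"
    proof (rule ccontr)
      assume "\<not> level x div int n < int (r * (A + B))"
      then have "int (r * (A + B)) * int n \<le> level x div int n * int n"
        by (intro mult_right_mono) auto
      also have "\<dots> \<le> level x"
        using n by (simp add: minus_mod_eq_div_mult[symmetric])
      finally show False using balanced_level_bounds(2)[OF lam n that] by simp
    qed
    ultimately show ?thesis by (simp add: rows_def)
  qed
  have "c div int n \<in> rows r" if "level_count lam c \<noteq> 0" for c
  proof -
    from that have "{x \<in> lam. level x = c} \<noteq> {}" unfolding level_count_def by (metis card.empty)
    then show ?thesis using rows by blast
  qed
  moreover have "(\<Sum>k\<in>rows r. level_count lam (k * int n + int t)) = r" if "t < n" for t
    using lam that
    by (subst card_color_eq_sum[symmetric])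
      (auto simp: fin rows finite_rows balanced_partitions_def balanced_def)
  ultimately show ?thesis
    using admissible_level_count[OF young] unfolding profiles_def by blast
qed

lemma diagram_of_balanced:
  assumes N: "N \<in> profiles r n" and n: "n > 0"
  shows "diagram_of N \<in> balanced_partitions r (int A) (- int B) n"
proof -
  define lam where "lam = diagram_of N"
  have "{c. N c \<noteq> 0} \<subseteq> (\<lambda>(k, t). k * int n + t) ` (rows r \<times> {0..<int n})"
  proof
    fix c assume "c \<in> {c. N c \<noteq> 0}"
    then have "c div int n \<in> rows r" using N by (simp add: profiles_def)
    moreover have "c = c div int n * int n + c mod int n" by simp
    ultimately show "c \<in> (\<lambda>(k, t). k * int n + t) ` (rows r \<times> {0..<int n})"
      using n by (intro image_eqI[of _ _ "(c div int n, c mod int n)"]) auto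
  qed
  then have young: "young_diagram lam"
    unfolding lam_def using N
    by (intro young_diagram_of) (auto simp: profiles_def finite_rows intro: finite_subset)
  then have fin: "finite lam" by (simp add: young_diagram_def)
  have "level x div int n \<in> rows r" if "x \<in> lam" for x
    using N that by (auto simp: lam_def diagram_of_def profiles_def)
  then have color: "card {x \<in> lam. box_color (int A) (- int B) n x = int t} = r" if "t < n" for t
    using N that
    by (subst card_color_eq_sum[OF fin, where K = "rows r"])
      (auto simp: finite_rows lam_def level_count_diagram_of profiles_def)
  have bal: "balanced (int A) (- int B) n r lam"
    unfolding balanced_def
  proof
    fix c assume "c \<in> {0..<int n}"
    then show "card {x \<in> lam. box_color (int A) (- int B) n x = c} = r"
      using color[of "nat c"] by (simp add: nat_less_iff)
  qed
  have "lam = (\<Union>c\<in>{0..<int n}. {x \<in> lam. box_color (int A) (- int B) n x = c})"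
    using n by (auto simp: box_color_def)
  also have "card \<dots> = (\<Sum>c\<in>{0..<int n}. card {x \<in> lam. box_color (int A) (- int B) n x = c})"
    by (rule card_UN_disjoint) (use fin in auto)
  also have "\<dots> = r * n" using bal by (simp add: balanced_def)
  finally show ?thesis using young bal by (simp add: balanced_partitions_def lam_def)
qed

lemma card_balanced_eq_card_profiles:
  assumes "n > 0"
  shows "card (balanced_partitions r (int A) (- int B) n) = card (profiles r n)"
proof (rule bij_betw_same_card[OF bij_betw_byWitness[where f' = diagram_of]])
  show "\<forall>lam\<in>balanced_partitions r (int A) (- int B) n. diagram_of (level_count lam) = lam"
    by (auto simp: balanced_partitions_def diagram_of_level_count)
  show "\<forall>N\<in>profiles r n. level_count (diagram_of N) = N"
    by (simp add: level_count_diagram_of)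
qed (use assms level_count_in_profiles diagram_of_balanced in auto)

text \<open>Passing to the diagram sharpens the support condition: it stays one row away from both
  ends of \<open>rows r\<close>. This slack leaves room for the columns past \<open>n\<close> in
  \<open>profile_row_eq_0\<close>.\<close>

lemma profile_support:
  assumes N: "N \<in> profiles r n" and n: "n > 0" and c: "N c \<noteq> 0"
  shows "- int (r * (A + B)) * int n \<le> c" "c < int (r * (A + B)) * int n"
proof -
  have "level_count (diagram_of N) c \<noteq> 0" using c by (simp add: level_count_diagram_of)
  then have "{x \<in> diagram_of N. level x = c} \<noteq> {}" unfolding level_count_def by (metis card.empty)
  then obtain x where "x \<in> diagram_of N" "level x = c" by blast
  then show "- int (r * (A + B)) * int n \<le> c" "c < int (r * (A + B)) * int n"
    using balanced_level_bounds[OF diagram_of_balanced[OF N n] n, of x] by auto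
qed

subsection \<open>Level counts as walks\<close>

definition P :: nat where "P = A * B"

definition join :: "(int \<times> nat \<Rightarrow> nat) \<Rightarrow> (int \<times> nat \<Rightarrow> nat) \<Rightarrow> int \<Rightarrow> nat \<Rightarrow> nat" where
  "join f g k s = (if s < P then f (k, s) else g (k, s - P))"

text \<open>This is \<open>admissible_at\<close> for the first \<open>p\<close> columns of the block
  \<open>g\<close>, with the preceding block \<open>f\<close> supplying entries further left.
  \<open>lo\<close> and \<open>hi\<close> stand for the comparisons of the level with 0 and
  \<open>B\<close>; \<open>k * l + s\<close> agrees with the level modulo \<open>P\<close>.\<close>

definition compatible ::
  "nat \<Rightarrow> (int \<Rightarrow> nat \<Rightarrow> bool) \<Rightarrow> (int \<Rightarrow> nat \<Rightarrow> bool) \<Rightarrow> nat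
    \<Rightarrow> (int \<times> nat \<Rightarrow> nat) \<Rightarrow> (int \<times> nat \<Rightarrow> nat) \<Rightarrow> bool" where
  "compatible l lo hi p f g \<longleftrightarrow> (\<forall>k. \<forall>s<p.
     g (k, s) \<le> join f g k (P + s - A) + of_bool (lo k s \<and> int B dvd k * int l + int s) \<and>
     join f g k (P + s - B) \<le> g (k, s) + of_bool (hi k s \<and> int A dvd k * int l + int s - int B))"

abbreviation inner_compatible where
  "inner_compatible l \<equiv> compatible l (\<lambda>k s. k < 0) (\<lambda>k s. k \<ge> 0) P"

text \<open>
  With \<open>n = l + m * P\<close>, the entry \<open>s\<close> of row \<open>k\<close> in block \<open>m\<close> (\<open>e = 0\<close>) or \<open>m + 1\<close> (\<open>e = P\<close>) has level
  \<open>(k + 1) * n + (e + s - l)\<close>, so row \<open>-1\<close> contains both signs there.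
\<close>

abbreviation end_compatible where
  "end_compatible l e \<equiv> compatible l (\<lambda>k s. k < -1 \<or> k = -1 \<and> e + s \<le> l)
     (\<lambda>k s. k \<ge> 0 \<or> k = -1 \<and> e + s \<ge> l + B)"

lemma A_le_P: "A \<le> P" and B_le_P: "B \<le> P" and P_pos: "P > 0"
  using A_pos B_pos by (simp_all add: P_def)

lemma compatible_iff_admissible:
  assumes n: "n = l + m * P" and "p \<le> P"
    and f: "\<And>k s. s < P \<Longrightarrow> f (k, s) = N (k * int n + int (i * P + s))"
    and g: "\<And>k s. s < p \<Longrightarrow> g (k, s) = N (k * int n + int (Suc i * P + s))"
    and lo: "\<And>k s. s < p \<Longrightarrow> lo k s \<longleftrightarrow> k * int n + int (Suc i * P + s) \<le> 0"
    and hi: "\<And>k s. s < p \<Longrightarrow> hi k s \<longleftrightarrow> k * int n + int (Suc i * P + s) \<ge> int B"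
  shows "compatible l lo hi p f g
    \<longleftrightarrow> (\<forall>k. \<forall>s<p. admissible_at N (k * int n + int (Suc i * P + s)))"
proof -
  have join: "join f g k (P + s - d) = N (k * int n + int (Suc i * P + s) - int d)"
    if "s < p" "0 < d" "d \<le> P" for k s d
  proof (cases "P + s - d < P")
    case True
    then have "join f g k (P + s - d) = N (k * int n + int (i * P + (P + s - d)))"
      by (simp add: join_def f)
    also have "int (i * P + (P + s - d)) = int (Suc i * P + s) - int d"
      using that by (simp add: of_nat_diff)
    finally show ?thesis by (simp add: algebra_simps)
  next
    case False
    then have "d \<le> s" "s - d < p" "P + s - d - P = s - d" using that by auto
    with False have "join f g k (P + s - d) = N (k * int n + int (Suc i * P + (s - d)))"
      by (simp add: join_def g)
    also have "int (Suc i * P + (s - d)) = int (Suc i * P + s) - int d"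
      using \<open>d \<le> s\<close> by (simp add: of_nat_diff)
    finally show ?thesis by (simp add: algebra_simps)
  qed
  \<comment> \<open>Both \<open>n - l\<close> and the offset of the block are multiples of
    \<open>P\<close>, so divisibility by \<open>A\<close> and \<open>B\<close> depends neither on
    \<open>m\<close> nor on the block.\<close>
  have eq: "k * int n + int (Suc i * P + s) = k * int l + int s + int P * (k * int m + int (Suc i))"
    for k s by (simp add: n algebra_simps)
  have dB: "int B dvd k * int n + int (Suc i * P + s) \<longleftrightarrow> int B dvd k * int l + int s" for k s
    unfolding eq by (rule dvd_add_left_iff) (simp add: P_def)
  have dA: "int A dvd k * int n + int (Suc i * P + s) - int B \<longleftrightarrow> int A dvd k * int l + int s - int B" for k s
  proof -
    have "k * int n + int (Suc i * P + s) - int B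
        = (k * int l + int s - int B) + int P * (k * int m + int (Suc i))"
      unfolding eq by simp
    then show ?thesis by (simp only:) (rule dvd_add_left_iff, simp add: P_def)
  qed
  show ?thesis
    unfolding compatible_def admissible_at_def dA dB
    using A_pos B_pos A_le_P B_le_P by (simp add: join g lo hi del: of_nat_add of_nat_mult mult_Suc)
qed

lemma inner_sign:
  assumes "0 < u" "u < n"
  shows "k * n + u \<le> 0 \<longleftrightarrow> k < (0::int)"
proof (cases "k < 0")
  case True
  then have "k * n \<le> (-1) * n" using assms by (intro mult_right_mono) auto
  with True assms show ?thesis by simp
next
  case False
  then have "0 \<le> k * n" using assms by simp
  with False assms show ?thesis by linarith
qed

text \<open>Applied with \<open>d = B\<close> for \<open>hi\<close>, and negated with
  \<open>d = 1\<close> for \<open>lo\<close>.\<close>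

lemma outer_sign:
  assumes "k < -1 \<Longrightarrow> w < n" "k \<ge> 0 \<Longrightarrow> d \<le> n + w" "0 < n" "d \<ge> (0::int)"
  shows "d \<le> (k + 1) * n + w \<longleftrightarrow> k \<ge> 0 \<or> k = -1 \<and> d \<le> w"
proof -
  consider "k < -1" | "k = -1" | "k \<ge> 0" by linarith
  then show ?thesis
  proof cases
    case 1
    then have "(k + 1) * n \<le> (-1) * n" using assms by (intro mult_right_mono) auto
    with 1 assms show ?thesis by simp
  next
    case 3
    then have "1 * n \<le> (k + 1) * n" using assms by (intro mult_right_mono) auto
    with 3 assms(2)[OF 3] show ?thesis by linarith
  qed simp
qed

text \<open>Blocks \<open>1\<close> to \<open>m - 1\<close> occupy columns from \<open>P\<close> up
  to below \<open>n\<close>. There the sign of the row decides whether the level is at most 0, and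
  since \<open>B \<le> P\<close> also whether it is at least \<open>B\<close>.\<close>

lemma inner_compatible_iff_admissible:
  assumes n: "n = l + m * P" and i: "Suc i < m"
    and f: "\<And>k s. s < P \<Longrightarrow> f (k, s) = N (k * int n + int (i * P + s))"
    and g: "\<And>k s. s < P \<Longrightarrow> g (k, s) = N (k * int n + int (Suc i * P + s))"
  shows "inner_compatible l f g
    \<longleftrightarrow> (\<forall>k. \<forall>s<P. admissible_at N (k * int n + int (Suc i * P + s)))"
proof (rule compatible_iff_admissible[OF n order.refl f g])
  fix k :: int and s assume s: "s < P"
  have "Suc (Suc i) * P \<le> m * P" using i by (intro mult_right_mono) auto
  then have lt: "Suc i * P + s < n" using s n by simp
  have ge: "P \<le> Suc i * P + s" by simp
  have u: "0 < int (Suc i * P + s)" "int (Suc i * P + s) < int n"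
    using lt ge P_pos by linarith+
  show "k < 0 \<longleftrightarrow> k * int n + int (Suc i * P + s) \<le> 0"
    using inner_sign[OF u] by simp
  show "k \<ge> 0 \<longleftrightarrow> k * int n + int (Suc i * P + s) \<ge> int B"
  proof (cases "k \<ge> 0")
    case True
    then have "0 \<le> k * int n" by simp
    then show ?thesis using True ge B_le_P by linarith
  next
    case False
    then show ?thesis using inner_sign[OF u, of k] B_pos by simp
  qed
qed

text \<open>The two cases of \<open>ep\<close> are the blocks \<open>U\<close> and \<open>V\<close>.
  Their columns lie so close to \<open>n\<close> that only in row \<open>-1\<close> does the
  comparison of the level with 0 or \<open>B\<close> depend on the column.\<close>

lemma end_compatible_iff_admissible:
  assumes n: "n = l + m * P" and "0 < m" "l < P" and ep: "e = 0 \<and> p = P \<or> e = P \<and> p = l"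
    and i: "Suc i * P = m * P + e"
    and f: "\<And>k s. s < P \<Longrightarrow> f (k, s) = N (k * int n + int (i * P + s))"
    and g: "\<And>k s. s < p \<Longrightarrow> g (k, s) = N (k * int n + int (Suc i * P + s))"
  shows "end_compatible l e p f g
    \<longleftrightarrow> (\<forall>k. \<forall>s<p. admissible_at N (k * int n + int (Suc i * P + s)))"
proof (rule compatible_iff_admissible[OF n _ f g])
  show "p \<le> P" using ep \<open>l < P\<close> by auto
  fix k :: int and s assume s: "s < p"
  define w where "w = int (e + s) - int l"
  have eq: "k * int n + int (Suc i * P + s) = (k + 1) * int n + w"
    unfolding i w_def by (simp add: n algebra_simps)
  have mP: "P \<le> m * P" using \<open>0 < m\<close> by simp
  have w: "- int l \<le> w" "w < int P" using s ep \<open>l < P\<close> by (auto simp: w_def)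
  have nP: "int n \<ge> int l + int P" using n mP by linarith
  show "k < -1 \<or> k = -1 \<and> e + s \<le> l \<longleftrightarrow> k * int n + int (Suc i * P + s) \<le> 0"
    unfolding eq using outer_sign[of k w "int n" 1] w nP P_pos by (auto simp: w_def)
  show "k \<ge> 0 \<or> k = -1 \<and> e + s \<ge> l + B \<longleftrightarrow> k * int n + int (Suc i * P + s) \<ge> int B"
    unfolding eq using outer_sign[of k w "int n" "int B"] w nP P_pos B_le_P by (auto simp: w_def)
qed

text \<open>Columns are taken from \<open>P\<close> to \<open>n + P - 1\<close> instead of from 0 to
  \<open>n - 1\<close>. This is still a full residue system modulo \<open>n\<close>, and steps back
  by \<open>A\<close> or \<open>B\<close> stay at nonnegative columns.\<close>

lemma all_int_iff_blocks:
  assumes n: "n = l + m * P" and "0 < m" "l < P"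
  shows "(\<forall>c. Q c) \<longleftrightarrow> (\<forall>i<m. \<forall>k. \<forall>s<P. Q (k * int n + int (Suc i * P + s)))
     \<and> (\<forall>k. \<forall>s<l. Q (k * int n + int (Suc m * P + s)))" (is "_ \<longleftrightarrow> ?R")
proof
  assume R: ?R
  show "\<forall>c. Q c"
  proof
    fix c
    have "n > 0" using n \<open>0 < m\<close> P_pos by simp
    define k where "k = (c - int P) div int n"
    define t where "t = nat ((c - int P) mod int n)"
    have t: "int t = (c - int P) mod int n" "t < n"
      using \<open>n > 0\<close> by (simp_all add: t_def nat_less_iff)
    define i where "i = t div P"
    define s where "s = t mod P"
    have it: "t = i * P + s" "s < P"
      unfolding i_def s_def using P_pos by (simp_all only: div_mult_mod_eq mod_less_divisor)
    have "c - int P = k * int n + int t" by (simp add: k_def t)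
    then have c: "c = k * int n + int (Suc i * P + s)" by (simp add: it)
    consider "i < m" | "i = m" "s < l"
    proof (cases "i < m")
      case False
      have "\<not> Suc m \<le> i"
      proof
        assume "Suc m \<le> i"
        then have "Suc m * P \<le> i * P" by (rule mult_le_mono1)
        then show False using it t(2) n \<open>l < P\<close> by simp
      qed
      with False have "i = m" by simp
      then show ?thesis using that it t(2) n by simp
    qed (use that in auto)
    then show "Q c" using R c it(2) by cases auto
  qed
qed blast

text \<open>The three conditions treat, in this order, the blocks \<open>1\<close> to
  \<open>m - 1\<close>, the block \<open>m\<close>, and the remaining \<open>l\<close>
  columns.\<close>

lemma all_admissible_iff_compatible:
  assumes n: "n = l + m * P" and "0 < m" "l < P" and "length xs = m"
    and xs: "\<And>i k s. i < m \<Longrightarrow> s < P \<Longrightarrow> (xs ! i) (k, s) = N (k * int n + int (i * P + s))"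
    and U: "\<And>k s. s < P \<Longrightarrow> U (k, s) = N (k * int n + int (m * P + s))"
    and V: "\<And>k s. s < l \<Longrightarrow> V (k, s) = N (k * int n + int (Suc m * P + s))"
  shows "(\<forall>c. admissible_at N c) \<longleftrightarrow> successively (inner_compatible l) xs
    \<and> end_compatible l 0 P (last xs) U \<and> end_compatible l P l U V"
proof -
  obtain m' where m': "m = Suc m'" using \<open>0 < m\<close> by (cases m) auto
  have last: "last xs = xs ! m'"
    using m' \<open>length xs = m\<close> by (metis diff_Suc_1 last_conv_nth length_0_conv nat.distinct(1))
  have 1: "successively (inner_compatible l) xs \<longleftrightarrow>
      (\<forall>i<m'. \<forall>k. \<forall>s<P. admissible_at N (k * int n + int (Suc i * P + s)))"
  proof -
    have "inner_compatible l (xs ! i) (xs ! Suc i) \<longleftrightarrow>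
        (\<forall>k. \<forall>s<P. admissible_at N (k * int n + int (Suc i * P + s)))" if "i < m'" for i
    proof (rule inner_compatible_iff_admissible[OF n])
      show "Suc i < m" using that m' by simp
      show "(xs ! i) (k, s) = N (k * int n + int (i * P + s))" if "s < P" for k s
        by (rule xs) (use that \<open>i < m'\<close> m' in simp_all)
      show "(xs ! Suc i) (k, s) = N (k * int n + int (Suc i * P + s))" if "s < P" for k s
        by (rule xs) (use that \<open>i < m'\<close> m' in simp_all)
    qed
    then show ?thesis
      unfolding successively_conv_nth \<open>length xs = m\<close> m' Suc_less_eq by blast
  qed
  have 2: "end_compatible l 0 P (last xs) U \<longleftrightarrow>
      (\<forall>k. \<forall>s<P. admissible_at N (k * int n + int (Suc m' * P + s)))"
    by (rule end_compatible_iff_admissible[OF n assms(2,3)]) (use xs U m' last in auto)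
  have 3: "end_compatible l P l U V \<longleftrightarrow>
      (\<forall>k. \<forall>s<l. admissible_at N (k * int n + int (Suc m * P + s)))"
    by (rule end_compatible_iff_admissible[OF n assms(2,3)]) (use U V in auto)
  show ?thesis
    unfolding 1 2 3 all_int_iff_blocks[OF n assms(2,3), of "admissible_at N"]
    unfolding m' less_Suc_eq by blast
qed

text \<open>Bounded functions supported on a fixed rectangle: a finite set independent of
  \<open>m\<close>, whose members are determined by their entries in the rectangle.\<close>

definition tables :: "nat \<Rightarrow> (int \<times> nat \<Rightarrow> nat) set" where
  "tables r = {f. \<forall>x. (x \<in> rows r \<times> {..<P} \<longrightarrow> f x \<in> {..r}) \<and> (x \<notin> rows r \<times> {..<P} \<longrightarrow> f x = 0)}"

definition states :: "nat \<Rightarrow> (int \<times> nat \<Rightarrow> nat) set" where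
  "states r = {f \<in> tables r. \<forall>s<P. (\<Sum>k\<in>rows r. f (k, s)) = r}"

text \<open>Monotonicity between blocks also relies on admissibility at columns of \<open>f\<close>,
  which compatibility of this pair does not test. Stating it here excludes all cycles other than
  loops, and walks coming from profiles satisfy it anyway.\<close>

definition transition where
  "transition l f g \<longleftrightarrow> inner_compatible l f g
     \<and> (\<forall>k. \<forall>s<P. (k \<ge> 0 \<longrightarrow> g (k, s) \<le> f (k, s)) \<and> (k < 0 \<longrightarrow> f (k, s) \<le> g (k, s)))"

text \<open>
  \<open>U\<close> and \<open>V\<close> continue the walk past column \<open>n\<close>, by a block and a partial block of width \<open>l\<close>, so that
  every level \<open>c\<close> occurs in a place where \<open>c - A\<close> and \<open>c - B\<close> lie in the same row. The columns from \<open>n\<close>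
  on repeat the first block one row higher.
\<close>

definition seam where
  "seam r l f g = (\<lambda>(U, V). (\<forall>k. \<forall>s<P. f (k + 1, s) = join U V k (l + s))
     \<and> (\<forall>s<l. (\<Sum>k\<in>rows r. U (k, s)) = r) \<and> (\<forall>k s. l \<le> s \<longrightarrow> V (k, s) = 0)
     \<and> end_compatible l 0 P g U \<and> end_compatible l P l U V)"

definition coded_profiles where
  "coded_profiles r l m = {(xs, z). length xs = m \<and> set xs \<subseteq> states r
     \<and> successively (transition l) xs \<and> z \<in> tables r \<times> tables r \<and> seam r l (hd xs) (last xs) z}"

definition block where
  "block n p i N = (\<lambda>(k, s). if s < p then N (k * int n + int (i * P + s)) else 0)"

definition encode where
  "encode l m N = (let n = l + m * P in
     (map (\<lambda>i. block n P i N) [0..<m], (block n P m N, block n l (Suc m) N)))"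

text \<open>The columns from 0 to \<open>n - 1\<close> are covered by the blocks in
  \<open>xs\<close> and the first \<open>l\<close> columns of \<open>U\<close>.\<close>

definition decode where
  "decode l m = (\<lambda>(xs, (U, V)) c.
     (let k = c div int (l + m * P); t = nat (c mod int (l + m * P)); i = t div P
      in (if i < m then xs ! i else U) (k, t mod P)))"

lemma finite_tables: "finite (tables r)"
  unfolding tables_def by (rule finite_set_of_finite_funs) (auto simp: finite_rows)

lemma states_subset_tables: "states r \<subseteq> tables r"
  by (auto simp: states_def)

lemma table_le: "f \<in> tables r \<Longrightarrow> f x \<le> r"
  unfolding tables_def mem_Collect_eq
  by (drule spec[of _ x], cases "x \<in> rows r \<times> {..<P}") simp_all

lemma table_eq_0: "f \<in> tables r \<Longrightarrow> k \<notin> rows r \<or> P \<le> s \<Longrightarrow> f (k, s) = 0"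
  by (auto simp: tables_def)

text \<open>The rank function of the graph. Along an edge, entries grow in negative rows and shrink
  in the others, so every summand is nondecreasing.\<close>

definition potential :: "nat \<Rightarrow> (int \<times> nat \<Rightarrow> nat) \<Rightarrow> nat" where
  "potential r f = (\<Sum>x\<in>rows r \<times> {..<P}. if fst x < 0 then f x else r - f x)"

lemma potential_less:
  assumes "f \<in> tables r" "g \<in> tables r" "transition l f g" "f \<noteq> g"
  shows "potential r f < potential r g"
proof -
  obtain k s where ne: "f (k, s) \<noteq> g (k, s)" using \<open>f \<noteq> g\<close> by (metis ext surj_pair)
  then have ks: "k \<in> rows r" "s < P"
    using table_eq_0[OF assms(1)] table_eq_0[OF assms(2)] by (metis not_le)+
  show ?thesis
    unfolding potential_def
  proof (rule sum_strict_mono_ex1)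
    show "finite (rows r \<times> {..<P})" by (simp add: finite_rows)
    have mono: "(if k < 0 then f (k, s) else r - f (k, s)) \<le> (if k < 0 then g (k, s) else r - g (k, s))"
      if "s < P" for k s
      using assms(3) that by (simp add: transition_def diff_le_mono2)
    then show "\<forall>x\<in>rows r \<times> {..<P}. (if fst x < 0 then f x else r - f x)
        \<le> (if fst x < 0 then g x else r - g x)" by auto
    \<comment> \<open>Entries of tables are at most \<open>r\<close>, so truncated subtraction from
      \<open>r\<close> preserves strictness.\<close>
    have "(if k < 0 then f (k, s) else r - f (k, s)) < (if k < 0 then g (k, s) else r - g (k, s))"
      using ne mono[OF ks(2), of k] table_le[OF assms(1), of "(k, s)"] table_le[OF assms(2), of "(k, s)"]
      by (auto split: if_splits)
    then show "\<exists>x\<in>rows r \<times> {..<P}. (if fst x < 0 then f x else r - f x)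
        < (if fst x < 0 then g x else r - g x)"
      using ks by (intro bexI[of _ "(k, s)"]) auto
  qed
qed

text \<open>The vertices, the edges and the marks \<open>(U, V)\<close> depend only on
  \<open>r\<close> and \<open>l\<close>; \<open>m\<close> is just the number of vertices of the
  walk.\<close>

lemma eventually_poly_card_coded_profiles: "eventually_poly (\<lambda>m. card (coded_profiles r l m))"
  unfolding coded_profiles_def
  by (rule eventually_poly_card_marked_walks[where rk = "potential r"])
    (use finite_tables states_subset_tables in
      \<open>auto intro: finite_subset potential_less simp: subset_iff\<close>)

section \<open>The bijection between profiles and coded walks\<close>

lemma admissible_antimono_nonneg:
  assumes "\<And>c. admissible_at N c" "c - int A * int j \<ge> 0"
  shows "N c \<le> N (c - int A * int j)"
  using assms(2)
proof (induction j)
  case (Suc j)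
  then have ge: "c - int A * int j > 0" using A_pos by (simp add: algebra_simps)
  then have "N c \<le> N (c - int A * int j)" using Suc.IH by simp
  also have "\<dots> \<le> N (c - int A * int j - int A)"
    using assms(1)[of "c - int A * int j"] ge by (simp add: admissible_at_def)
  finally show ?case by (simp add: algebra_simps)
qed simp

lemma admissible_mono_neg:
  assumes "\<And>c. admissible_at N c" "c < 0"
  shows "N (c - int B * int j) \<le> N c"
proof (induction j)
  case (Suc j)
  have "0 \<le> int B * int j" by simp
  \<comment> \<open>Below \<open>B\<close> the second inequality of \<open>admissible_at\<close> has
    no extra 1.\<close>
  then have "c - int B * int j < int B" using \<open>c < 0\<close> by linarith
  then have "N (c - int B * int j - int B) \<le> N (c - int B * int j)"
    using assms(1)[of "c - int B * int j"] by (simp add: admissible_at_def)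
  then show ?case using Suc.IH by (simp add: algebra_simps)
qed simp

text \<open>The range of \<open>u\<close> extends to \<open>2 * n\<close> in order to include all
  columns of \<open>U\<close> and \<open>V\<close>.\<close>

lemma profile_row_eq_0:
  assumes N: "N \<in> profiles r n" and u: "u < 2 * n" and k: "k \<notin> rows r"
  shows "N (k * int n + int u) = 0"
proof (rule ccontr)
  assume *: "\<not> ?thesis"
  have "n > 0" using u by simp
  note b = profile_support[OF N this *]
  define S where "S = int (r * (A + B))"
  consider "k \<ge> S + 1" | "k \<le> - S - 2" using k unfolding rows_def S_def[symmetric] by force
  then show False
  proof cases
    case 1
    then have "S * int n \<le> k * int n" by (intro mult_right_mono) auto
    then show False using b(2) unfolding S_def[symmetric] by linarith
  next
    case 2
    then have "k * int n \<le> (- S - 2) * int n" by (intro mult_right_mono) auto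
    also have "\<dots> = - S * int n - 2 * int n" by (simp add: algebra_simps)
    finally show False using b(1) u unfolding S_def[symmetric] by linarith
  qed
qed

lemma profile_le:
  assumes N: "N \<in> profiles r n" and "n > 0"
  shows "N c \<le> r"
proof (cases "c div int n \<in> rows r")
  case True
  define t where "t = nat (c mod int n)"
  have t: "int t = c mod int n" "t < n" using \<open>n > 0\<close> by (simp_all add: t_def nat_less_iff)
  have "N (c div int n * int n + int t) \<le> (\<Sum>k\<in>rows r. N (k * int n + int t))"
    using member_le_sum[OF True, of "\<lambda>k. N (k * int n + int t)"] by (simp add: finite_rows)
  also have "\<dots> = r" using N t(2) by (simp add: profiles_def)
  finally show ?thesis by (simp add: t(1))
next
  case False
  then have "N c = 0" using N unfolding profiles_def by blast
  then show ?thesis by simp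
qed

lemma encode_in_coded_profiles:
  assumes N: "N \<in> profiles r (l + m * P)" and "l < P" "m \<ge> 2"
  shows "encode l m N \<in> coded_profiles r l m"
proof -
  define n where "n = l + m * P"
  note N = N[folded n_def]
  have "2 * P \<le> m * P" using \<open>m \<ge> 2\<close> by (rule mult_le_mono1)
  then have nP: "2 * P \<le> n" unfolding n_def by linarith
  then have "n > 0" using P_pos by linarith
  have adm: "admissible_at N c" for c using N by (simp add: profiles_def)
  have sum: "(\<Sum>k\<in>rows r. N (k * int n + int t)) = r" if "t < n" for t
    using N that by (simp add: profiles_def)
  have pos_lt: "i * P + s < n" if "i < m" "s < P" for i s
  proof -
    have "Suc i * P \<le> m * P" using that by (intro mult_le_mono1) auto
    then show ?thesis using that by (simp add: n_def)
  qed
  define xs where "xs = map (\<lambda>i. block n P i N) [0..<m]"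
  define U where "U = block n P m N"
  define V where "V = block n l (Suc m) N"
  have enc: "encode l m N = (xs, (U, V))"
    by (simp add: encode_def Let_def xs_def U_def V_def n_def)
  have len: "length xs = m" by (simp add: xs_def)
  have nth: "xs ! i = block n P i N" if "i < m" for i using that by (simp add: xs_def)
  have table: "block n p i N \<in> tables r" if "p \<le> P" "i \<le> Suc m" "i = Suc m \<Longrightarrow> p \<le> l" for i p
  proof -
    have "block n p i N (k, s) = 0" if "k \<notin> rows r" for k s
    proof (cases "s < p")
      case True
      have "i * P + s < 2 * n"
      proof (cases "i = Suc m")
        case F: False
        then have "i * P \<le> m * P" using \<open>i \<le> Suc m\<close> by (intro mult_le_mono1) auto
        moreover have "P \<le> m * P" using \<open>m \<ge> 2\<close> by simp
        then have "s < m * P" using True \<open>p \<le> P\<close> by (meson less_le_trans)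
        ultimately have "i * P + s < m * P + m * P" by (rule add_le_less_mono)
        then show ?thesis by (simp add: n_def)
      next
        case T: True
        then show ?thesis using True \<open>i = Suc m \<Longrightarrow> p \<le> l\<close> nP by (simp add: n_def)
      qed
      from profile_row_eq_0[OF N this that] show ?thesis
        using True by (simp add: block_def del: of_nat_add of_nat_mult)
    qed (simp add: block_def)
    moreover have "block n p i N (k, s) = 0" if "P \<le> s" for k s
      using that \<open>p \<le> P\<close> by (simp add: block_def)
    moreover have "block n p i N (k, s) \<le> r" for k s
      using profile_le[OF N \<open>n > 0\<close>] by (simp add: block_def)
    ultimately show ?thesis
      unfolding tables_def by (auto simp: not_less)
  qed
  have states: "set xs \<subseteq> states r"
    using table[of P] sum[OF pos_lt] by (auto simp: xs_def states_def block_def)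
  have "successively (inner_compatible l) xs
    \<and> end_compatible l 0 P (last xs) U \<and> end_compatible l P l U V"
    by (subst all_admissible_iff_compatible[symmetric, where N = N and m = m and n = n])
      (use adm \<open>m \<ge> 2\<close> \<open>l < P\<close> len nth in \<open>auto simp: n_def U_def V_def block_def\<close>)
  note comp = this
  have trans: "successively (transition l) xs"
    unfolding successively_conv_nth len transition_def
  proof (intro allI impI conjI)
    fix i assume i: "Suc i < m"
    show "inner_compatible l (xs ! i) (xs ! Suc i)"
      using comp i by (simp add: successively_conv_nth len)
    fix k :: int and s assume s: "s < P"
    \<comment> \<open>One block back means lowering the level by \<open>P\<close>: \<open>B\<close>
      steps of size \<open>A\<close> in nonnegative rows, \<open>A\<close> steps of size
      \<open>B\<close> in negative ones.\<close>
    define c where "c = k * int n + int (Suc i * P + s)"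
    have e: "(xs ! Suc i) (k, s) = N c" "(xs ! i) (k, s) = N (c - int A * int B)"
      using i s by (simp_all add: nth block_def c_def P_def algebra_simps)
    show "(xs ! Suc i) (k, s) \<le> (xs ! i) (k, s)" if "k \<ge> 0"
    proof -
      have "0 \<le> k * int n" using that by simp
      then have "c - int A * int B \<ge> 0" by (simp add: c_def P_def)
      then show ?thesis unfolding e by (rule admissible_antimono_nonneg[OF adm])
    qed
    show "(xs ! i) (k, s) \<le> (xs ! Suc i) (k, s)" if "k < 0"
    proof -
      have "k * int n \<le> (-1) * int n" using that by (intro mult_right_mono) auto
      then have "c < 0" using pos_lt[OF i s] unfolding c_def by linarith
      then show ?thesis unfolding e by (subst mult.commute) (rule admissible_mono_neg[OF adm])
    qed
  qed
  have "seam r l (hd xs) (last xs) (U, V)"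
    unfolding seam_def prod.case
  proof (intro conjI allI impI)
    fix k :: int and s assume s: "s < P"
    have "hd xs = block n P 0 N" using nth[of 0] hd_conv_nth[of xs] \<open>m \<ge> 2\<close> len by force
    \<comment> \<open>Column \<open>s\<close> of row \<open>k + 1\<close> is column
      \<open>n + s\<close> of row \<open>k\<close>, hence position \<open>l + s\<close> counted from
      the start of \<open>U\<close>.\<close>
    then have "hd xs (k + 1, s) = N (k * int n + int (m * P + (l + s)))"
      using s by (simp add: block_def n_def algebra_simps)
    also have "\<dots> = join U V k (l + s)"
    proof (cases "l + s < P")
      case False
      then have "Suc m * P + (l + s - P) = m * P + (l + s)" "l + s - P < l" using s by simp_all
      then show ?thesis using False by (simp add: join_def V_def block_def)
    qed (simp add: join_def U_def block_def)
    finally show "hd xs (k + 1, s) = join U V k (l + s)" .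
  next
    fix s assume "s < l"
    then show "(\<Sum>k\<in>rows r. U (k, s)) = r"
      using sum[of "m * P + s"] \<open>l < P\<close> by (simp add: U_def block_def n_def)
  qed (use comp in \<open>auto simp: V_def block_def\<close>)
  then show ?thesis
    unfolding enc using states trans table[of P m] table[of l "Suc m"] \<open>l < P\<close>
    by (simp add: coded_profiles_def len U_def V_def)
qed

text \<open>Columns below \<open>n\<close> can be read off from \<open>decode\<close>. From column
  \<open>n\<close> on, the values are those of the first block one row higher, and
  \<open>seam\<close> identifies them with the rest of \<open>U\<close> and with
  \<open>V\<close>.\<close>

lemma decode_at:
  assumes z: "(xs, (U, V)) \<in> coded_profiles r l m" and "l < P" "m \<ge> 1" and n: "n = l + m * P"
    and N: "N = decode l m (xs, (U, V))"
  shows "i < m \<Longrightarrow> s < P \<Longrightarrow> N (k * int n + int (i * P + s)) = (xs ! i) (k, s)"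
    and "s < P \<Longrightarrow> N (k * int n + int (m * P + s)) = U (k, s)"
    and "s < l \<Longrightarrow> N (k * int n + int (Suc m * P + s)) = V (k, s)"
proof -
  have "P \<le> m * P" using \<open>m \<ge> 1\<close> by simp
  then have "n > 0" "P \<le> n" using P_pos n by linarith+
  have low: "N (k * int n + int t) = (if t div P < m then xs ! (t div P) else U) (k, t mod P)"
    if "t < n" for t k
    using that by (simp add: N decode_def n[symmetric] Let_def)
  have nth: "N (k * int n + int (i * P + s)) = (xs ! i) (k, s)" if "i < m" "s < P" for i s k
  proof -
    have "Suc i * P \<le> m * P" using that by (intro mult_le_mono1) auto
    then have "i * P + s < n" using that by (simp add: n)
    from low[OF this, of k] that show ?thesis by simp
  qed
  then show "i < m \<Longrightarrow> s < P \<Longrightarrow> N (k * int n + int (i * P + s)) = (xs ! i) (k, s)" .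
  have seam: "seam r l (hd xs) (last xs) (U, V)" "length xs = m"
    using z by (auto simp: coded_profiles_def)
  then have hd: "hd xs = xs ! 0" using \<open>m \<ge> 1\<close> by (intro hd_conv_nth) auto
  have high: "N (k * int n + int (n + s)) = join U V k (l + s)" if "s < P" for k s
  proof -
    have "N (k * int n + int (n + s)) = N ((k + 1) * int n + int (0 * P + s))"
      by (simp add: algebra_simps)
    also have "\<dots> = hd xs (k + 1, s)" using nth[of 0 s] that \<open>m \<ge> 1\<close> hd by simp
    finally show ?thesis using seam(1) that by (simp add: seam_def)
  qed
  show "N (k * int n + int (m * P + s)) = U (k, s)" if "s < P"
  proof (cases "s < l")
    case True
    then have "m * P + s < n" by (simp add: n)
    from low[OF this, of k] that show ?thesis by simp
  next
    case False
    then have "n + (s - l) = m * P + s" by (simp add: n)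
    then show ?thesis using high[of "s - l" k] False that by (simp add: join_def)
  qed
  show "N (k * int n + int (Suc m * P + s)) = V (k, s)" if "s < l"
  proof -
    have "n + (P + s - l) = Suc m * P + s" "P + s - l < P" using that \<open>l < P\<close> by (simp_all add: n)
    then show ?thesis using high[of "P + s - l" k] that \<open>l < P\<close> by (simp add: join_def)
  qed
qed

lemma decode_in_profiles:
  assumes z: "(xs, (U, V)) \<in> coded_profiles r l m" and "l < P" "m \<ge> 1"
  shows "decode l m (xs, (U, V)) \<in> profiles r (l + m * P)"
proof -
  define n where "n = l + m * P"
  define N where "N = decode l m (xs, (U, V))"
  note at = decode_at[OF assms n_def N_def]
  have len: "length xs = m" and st: "set xs \<subseteq> states r" and "successively (transition l) xs"
    and tab: "U \<in> tables r" and seam: "seam r l (hd xs) (last xs) (U, V)"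
    using z by (auto simp: coded_profiles_def)
  have comp: "successively (inner_compatible l) xs"
    using \<open>successively (transition l) xs\<close> by (simp add: successively_conv_nth transition_def)
  have adm: "\<forall>c. admissible_at N c"
    by (subst all_admissible_iff_compatible[OF n_def, where xs = xs and U = U and V = V])
      (use assms len at comp seam in \<open>auto simp: seam_def\<close>)
  have "n > 0" using n_def \<open>m \<ge> 1\<close> P_pos by simp
  have st_nth: "xs ! i \<in> states r" if "i < m" for i using st len that by force
  have row: "c div int n \<in> rows r" if "N c \<noteq> 0" for c
  proof (rule ccontr)
    assume k: "c div int n \<notin> rows r"
    have "(if i < m then xs ! i else U) \<in> tables r" for i
      using st_nth[of i] states_subset_tables tab by auto
    then have "N c = 0"
      unfolding N_def decode_def prod.case Let_def n_def[symmetric]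
      by (rule table_eq_0) (use k in simp)
    with that show False by simp
  qed
  have "(\<Sum>k\<in>rows r. N (k * int n + int t)) = r" if "t < n" for t
  proof -
    define i and s where "i = t div P" and "s = t mod P"
    have t: "t = i * P + s" "s < P"
      unfolding i_def s_def using P_pos by (simp_all only: div_mult_mod_eq mod_less_divisor)
    show ?thesis
    proof (cases "i < m")
      case True
      then show ?thesis using st_nth[OF True] t at(1)[OF True t(2)] by (simp add: states_def)
    next
      case False
      have "\<not> Suc m \<le> i"
      proof
        assume "Suc m \<le> i"
        then have "Suc m * P \<le> i * P" by (rule mult_le_mono1)
        then show False using t that n_def \<open>l < P\<close> by simp
      qed
      with False have "i = m" by simp
      \<comment> \<open>These are the columns of \<open>U\<close> before column \<open>n\<close>,
        whose sums are prescribed by \<open>seam\<close>.\<close>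
      then have "s < l" using t that n_def by simp
      then show ?thesis using seam \<open>i = m\<close> t at(2)[OF t(2)] by (simp add: seam_def)
    qed
  qed
  then show ?thesis using adm row by (auto simp: profiles_def n_def[symmetric] N_def[symmetric])
qed

lemma decode_encode:
  assumes "l < P" "m \<ge> 1"
  shows "decode l m (encode l m N) = N"
proof
  fix c
  define n where "n = l + m * P"
  have "n > 0" using n_def \<open>m \<ge> 1\<close> P_pos by simp
  define k where "k = c div int n"
  define t where "t = nat (c mod int n)"
  have t: "int t = c mod int n" "t < n"
    using \<open>n > 0\<close> by (simp_all add: t_def nat_less_iff)
  have c: "c = k * int n + int t" by (simp add: k_def t)
  have tt: "t = t div P * P + t mod P" "t mod P < P"
    using P_pos by (simp_all only: div_mult_mod_eq mod_less_divisor)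
  have dm: "t div P = m" if "\<not> t div P < m"
  proof -
    have "\<not> Suc m \<le> t div P"
    proof
      assume "Suc m \<le> t div P"
      then have "Suc m * P \<le> t div P * P" by (rule mult_le_mono1)
      then show False using tt t n_def \<open>l < P\<close> by simp
    qed
    with that show ?thesis by simp
  qed
  have "decode l m (encode l m N) c = block n P (t div P) N (k, t mod P)"
    unfolding decode_def encode_def prod.case Let_def n_def[symmetric] k_def[symmetric] t_def[symmetric]
    using dm by (cases "t div P < m") auto
  also have "\<dots> = N c" using tt c by (simp add: block_def)
  finally show "decode l m (encode l m N) c = N c" .
qed

lemma encode_decode:
  assumes z: "z \<in> coded_profiles r l m" and "l < P" "m \<ge> 1"
  shows "encode l m (decode l m z) = z"
proof -
  obtain xs U V where zeq: "z = (xs, (U, V))" by (metis surj_pair)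
  define n where "n = l + m * P"
  define N where "N = decode l m (xs, (U, V))"
  note at = decode_at[OF z[unfolded zeq] assms(2,3) n_def N_def]
  have len: "length xs = m" and st: "set xs \<subseteq> states r"
    and tab: "U \<in> tables r" "V \<in> tables r" and seam: "seam r l (hd xs) (last xs) (U, V)"
    using z by (auto simp: coded_profiles_def zeq)
  have "block n P i N = xs ! i" if "i < m" for i
  proof -
    have "xs ! i \<in> tables r" using st len that states_subset_tables by force
    then show ?thesis using table_eq_0 at(1)[OF that] by (auto simp: block_def fun_eq_iff)
  qed
  then have 1: "map (\<lambda>i. block n P i N) [0..<m] = xs" using len by (auto intro: nth_equalityI)
  have 2: "block n P m N = U" using table_eq_0[OF tab(1)] at(2) by (auto simp: block_def fun_eq_iff)
  have 3: "block n l (Suc m) N = V" using seam at(3) by (auto simp: block_def fun_eq_iff seam_def)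
  show ?thesis
    unfolding zeq encode_def Let_def n_def[symmetric] N_def[symmetric] 1 2 3 ..
qed

lemma card_profiles_eq:
  assumes "l < P" "m \<ge> 2"
  shows "card (profiles r (l + m * P)) = card (coded_profiles r l m)"
  by (rule bij_betw_same_card[OF bij_betw_byWitness[where f = "encode l m" and f' = "decode l m"]])
    (use assms encode_in_coded_profiles decode_in_profiles in
      \<open>auto simp: decode_encode encode_decode\<close>)

lemma balanced_count_quasipolynomial:
  "\<exists>M. \<exists>p :: nat \<Rightarrow> real poly. \<forall>n\<ge>M.
     real (card (balanced_partitions r (int A) (- int B) n)) = poly (p (n mod P)) (real n)"
proof -
  have "\<exists>q :: real poly. \<exists>M. \<forall>m\<ge>M. real (card (coded_profiles r l m)) = poly q (real m)" for l
    using eventually_poly_card_coded_profiles[of r l]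
    unfolding eventually_poly_def eventually_sequentially by blast
  then obtain q :: "nat \<Rightarrow> real poly" and M where
    q: "real (card (coded_profiles r l m)) = poly (q l) (real m)" if "m \<ge> M l" for l m
    by metis
  \<comment> \<open>The sum dominates the thresholds of all residues at once, and the 2 provides
    \<open>m \<ge> 2\<close>.\<close>
  define K where "K = 2 + (\<Sum>l<P. M l)"
  \<comment> \<open>Substitutes \<open>m = (n - l) / P\<close>.\<close>
  define p where "p l = q l \<circ>\<^sub>p [:- real l / real P, 1 / real P:]" for l
  have "real (card (balanced_partitions r (int A) (- int B) n)) = poly (p (n mod P)) (real n)"
    if n: "n \<ge> K * P" for n
  proof -
    define l and m where "l = n mod P" and "m = n div P"
    have nlm: "n = l + m * P" unfolding l_def m_def by (simp only: mod_div_mult_eq)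
    have "l < P" using P_pos by (simp add: l_def)
    have "K \<le> m" using n P_pos by (simp add: m_def less_eq_div_iff_mult_less_eq)
    moreover have "M l \<le> (\<Sum>l<P. M l)" using \<open>l < P\<close> by (intro member_le_sum) auto
    ultimately have m: "m \<ge> 2" "m \<ge> M l" by (simp_all add: K_def)
    then have "n > 0" using nlm P_pos by simp
    have "real (card (balanced_partitions r (int A) (- int B) n)) = real (card (coded_profiles r l m))"
      using card_balanced_eq_card_profiles[OF \<open>n > 0\<close>] card_profiles_eq[OF \<open>l < P\<close> m(1)] nlm by simp
    also have "\<dots> = poly (q l) (real m)" using q m by simp
    also have "real m = (real n - real l) / real P" using nlm P_pos by simp
    also have "poly (q l) \<dots> = poly (p l) (real n)"
      by (simp add: p_def poly_pcompose diff_divide_distrib)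
    finally show ?thesis by (simp add: l_def)
  qed
  then show ?thesis by blast
qed

end

section \<open>Transposition and the general case\<close>

lemma bij_betw_swap_balanced:
  "bij_betw ((`) prod.swap) (balanced_partitions r a b n) (balanced_partitions r b a n)"
proof (rule bij_betw_byWitness[where f' = "(`) prod.swap"])
  have "prod.swap ` lam \<in> balanced_partitions r b a n" if "lam \<in> balanced_partitions r a b n" for a b lam
  proof -
    have "{x \<in> prod.swap ` lam. box_color b a n x = c} = prod.swap ` {x \<in> lam. box_color a b n x = c}" for c
      by (auto simp: box_color_def add.commute)
    then have "card {x \<in> prod.swap ` lam. box_color b a n x = c} = card {x \<in> lam. box_color a b n x = c}" for c
      by (simp add: card_image)
    moreover have "young_diagram (prod.swap ` lam)"
      using that by (auto simp: balanced_partitions_def young_diagram_def)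
    ultimately show ?thesis using that by (simp add: balanced_partitions_def balanced_def card_image)
  qed
  then show "(`) prod.swap ` balanced_partitions r a b n \<subseteq> balanced_partitions r b a n"
    "(`) prod.swap ` balanced_partitions r b a n \<subseteq> balanced_partitions r a b n" by auto
qed (simp_all add: image_image)

theorem theorem1p3:
  fixes r :: nat and a b :: int
  assumes "r > 0" and "gcd a b = 1" and "a * b < 0"
  shows "\<exists>N :: nat. \<exists>p :: nat \<Rightarrow> real poly.
           \<forall>n \<ge> N. real (card (balanced_partitions r a b n))
                     = poly (p (n mod nat \<bar>a * b\<bar>)) (real n)"
proof -
  have pos_neg: "\<exists>N :: nat. \<exists>p :: nat \<Rightarrow> real poly.
           \<forall>n \<ge> N. real (card (balanced_partitions r a b n))
                     = poly (p (n mod nat \<bar>a * b\<bar>)) (real n)"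
    if "a > 0" "b < 0" "gcd a b = 1" for a b
  proof -
    define A B where "A = nat a" and "B = nat (- b)"
    have ab: "a = int A" "b = - int B" using that by (simp_all add: A_def B_def)
    interpret weights A B
      by standard (use that in \<open>auto simp: ab coprime_iff_gcd_eq_1\<close>)
    have "nat \<bar>a * b\<bar> = A * B" by (simp add: ab abs_mult nat_mult_distrib)
    then show ?thesis using balanced_count_quasipolynomial[of r] by (simp add: ab P_def)
  qed
  consider "a > 0" "b < 0" | "b > 0" "a < 0"
    using \<open>a * b < 0\<close> by (auto simp: mult_less_0_iff)
  then show ?thesis
  proof cases
    case 1
    then show ?thesis using pos_neg[OF 1] assms by simp
  next
    case 2
    have "card (balanced_partitions r a b n) = card (balanced_partitions r b a n)" for n
      using bij_betw_same_card[OF bij_betw_swap_balanced] .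
    then show ?thesis using pos_neg[OF 2] assms by (simp add: gcd.commute mult.commute)
  qed
qed

end
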